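(* Let $L>0$, $R>0$, and let $N,d\in\mathbb{N}$ with $N,d\ge 1$. Then for every $h>0$ there exist a convex function $\varphi\in C^{1,1}_L(\mathbb{R}^d)$ which attains its minimum value $\varphi^\ast$, and a point $x_0\in\mathbb{R}^d$ whose distance to some minimizer $x_\ast$ of $\varphi$ satisfies $\|x_\ast-x_0\|\le R$, such that the point $x_N$ obtained after $N$ iterations of the gradient method $$x_{i+1}=x_i-\frac{h}{L}\varphi'(x_i),\qquad i=0,\dots,N-1,$$ satisfies $$\varphi(x_N)-\varphi^\ast=\frac{LR^2}{2}\max\left(\frac{1}{2Nh+1},\,(1-h)^{2N}\right).$$
   Context: $\|\cdot\|$ is the Euclidean norm on $\mathbb{R}^d$ and $\varphi'(x)$ denotes the gradient of $\varphi$ at $x$. $C^{1,1}_L(\mathbb{R}^d)$ is the class of continuously differentiable functions $\varphi:\mathbb{R}^d\to\mathbb{R}$ with $\|\varphi'(x)-\varphi'(y)\|\le L\|x-y\|$ for all $x,y\in\mathbb{R}^d$. *)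

theory Defs
  imports "HOL-Analysis.Analysis"
begin

text \<open>Only meaningful at points where \<open>f\<close> is differentiable; elsewhere the value is unspecified.\<close>

definition gradient :: "(real ^ 'd \<Rightarrow> real) \<Rightarrow> real ^ 'd \<Rightarrow> real ^ 'd" where
  "gradient f x = (THE g. GDERIV f x :> g)"

lemma gradient_eqI:
  assumes "GDERIV f x :> g"
  shows "gradient f x = g"
  unfolding gradient_def
proof (rule the_equality, rule assms)
  fix g' assume "GDERIV f x :> g'"
  then have "(\<lambda>h. h \<bullet> g') = (\<lambda>h. h \<bullet> g)"
    using assms unfolding gderiv_def by (rule has_derivative_unique)
  then have "\<forall>h. h \<bullet> g' = h \<bullet> g"
    by (blast dest: fun_cong)
  then show "g' = g"
    by (simp only: vector_eq_ldot)
qed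

definition C11 :: "real \<Rightarrow> (real ^ 'd \<Rightarrow> real) set" where
  "C11 L = {f. (\<forall>x. f differentiable (at x)) \<and>
               continuous_on UNIV (gradient f) \<and>
               (\<forall>x y. norm (gradient f x - gradient f y) \<le> L * norm (x - y))}"

end

theory Submission
  imports Defs
begin

text \<open>
  Each of the two terms of the maximum, multiplied by \<open>L * R\<^sup>2 / 2\<close>, is the exact final error of
  the method on a one-dimensional function started at distance \<open>R\<close> from its minimizer \<open>0\<close>, so it
  is enough to pick the function that belongs to the larger term.

  \<^item> On the parabola \<open>L / 2 * t\<^sup>2\<close> every step multiplies the iterate by \<open>1 - h\<close>. This is
    the bad case for large \<open>h\<close>, where the method overshoots.

  \<^item> On a parabola that is continued by its tangent line for \<open>t > a\<close> (half of a Huber function), the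
    iterates walk down the line with the constant step \<open>h * a\<close>. This is the bad case for small
    \<open>h\<close>. A flat line leaves little error to begin with, a steep one lets the iterates travel far.
    If the iterates stay on the line, the final error is
    \<open>L * a * (R - N * h * a) - L * a\<^sup>2 / 2\<close>, which is greatest at \<open>a = R / (2 * N * h + 1)\<close>;
    for this \<open>a\<close> the iterates do stay on the line, and the error is
    \<open>L * R\<^sup>2 / 2 * (1 / (2 * N * h + 1))\<close>.

  Both functions are carried to \<open>d\<close> dimensions by composing them with one coordinate:
  the gradient is then a multiple of one coordinate vector, and the method started on that axis
  stays on it and performs the one-dimensional iteration
  (\<open>gradient_method_along_coordinate\<close>).
\<close>

lemma GDERIV_coordinate_function:
  fixes f f' :: "real \<Rightarrow> real" and x :: "real ^ 'd"
  assumes "\<And>t. (f has_real_derivative f' t) (at t)"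
  shows "GDERIV (\<lambda>y. f (y $ k)) x :> f' (x $ k) *\<^sub>R axis k 1"
proof -
  have "((\<lambda>y::real ^ 'd. y $ k) has_derivative (\<lambda>y. y $ k)) (at x)"
    by (rule bounded_linear_imp_has_derivative[OF bounded_linear_vec_nth])
  moreover have "(f has_derivative (*) (f' (x $ k))) (at (x $ k))"
    using assms[of "x $ k"] by (simp add: has_field_derivative_def)
  ultimately have "((\<lambda>y. f (y $ k)) has_derivative (\<lambda>y. f' (x $ k) * (y $ k))) (at x)"
    by (rule has_derivative_compose)
  then show ?thesis
    by (simp add: gderiv_def inner_axis)
qed

lemma coordinate_function_in_C11:
  fixes f f' :: "real \<Rightarrow> real"
  assumes deriv: "\<And>t. (f has_real_derivative f' t) (at t)"
    and lipschitz: "\<And>s t. \<bar>f' s - f' t\<bar> \<le> L * \<bar>s - t\<bar>" and "L \<ge> 0"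
  shows "(\<lambda>y :: real ^ 'd. f (y $ k)) \<in> C11 L"
proof -
  let ?\<phi> = "\<lambda>y :: real ^ 'd. f (y $ k)"
  have gradient: "gradient ?\<phi> x = f' (x $ k) *\<^sub>R axis k 1" for x
    by (rule gradient_eqI, rule GDERIV_coordinate_function, rule deriv)
  have bound: "norm (gradient ?\<phi> x - gradient ?\<phi> y) \<le> L * norm (x - y)" for x y
  proof -
    have "norm (gradient ?\<phi> x - gradient ?\<phi> y) = \<bar>f' (x $ k) - f' (y $ k)\<bar>"
      by (simp add: gradient flip: scaleR_diff_left)
    also have "\<dots> \<le> L * \<bar>(x - y) $ k\<bar>"
      using lipschitz by simp
    also have "\<dots> \<le> L * norm (x - y)"
      using component_le_norm_cart \<open>L \<ge> 0\<close> by (rule mult_left_mono)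
    finally show ?thesis .
  qed
  have "L-lipschitz_on UNIV (gradient ?\<phi>)"
    using bound \<open>L \<ge> 0\<close> by (intro lipschitz_onI) (auto simp: dist_norm)
  then have "continuous_on UNIV (gradient ?\<phi>)"
    by (rule lipschitz_on_continuous_on)
  moreover have "?\<phi> differentiable (at x)" for x
    using GDERIV_coordinate_function[OF deriv]
    unfolding gderiv_def by (rule differentiableI)
  ultimately show ?thesis
    using bound by (simp add: C11_def)
qed

text \<open>The reduction to dimension one: a convex function of one variable with minimizer \<open>0\<close> and a
  run \<open>t\<close> of the method on it give, on any coordinate axis, a function and a run in dimension
  \<open>d\<close> with the same final error \<open>E\<close>.\<close>

lemma gradient_method_along_coordinate:
  fixes f f' :: "real \<Rightarrow> real" and t :: "nat \<Rightarrow> real"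
  assumes deriv: "\<And>s. (f has_real_derivative f' s) (at s)"
    and lipschitz: "\<And>s u. \<bar>f' s - f' u\<bar> \<le> L * \<bar>s - u\<bar>" and "L \<ge> 0"
    and mono: "mono f'" and critical: "f' 0 = 0"
    and start: "\<bar>t 0\<bar> \<le> R"
    and step: "\<And>i. i < N \<Longrightarrow> t (Suc i) = t i - h / L * f' (t i)"
    and error: "f (t N) - f 0 = E"
  shows "\<exists>(\<phi> :: real ^ 'd \<Rightarrow> real) (xstar :: real ^ 'd) (x :: nat \<Rightarrow> real ^ 'd).
           \<phi> \<in> C11 L \<and> convex_on UNIV \<phi> \<and>
           (\<forall>y. \<phi> xstar \<le> \<phi> y) \<and>
           norm (xstar - x 0) \<le> R \<and>
           (\<forall>i<N. x (Suc i) = x i - (h / L) *\<^sub>R gradient \<phi> (x i)) \<and>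
           \<phi> (x N) - \<phi> xstar = E"
proof -
  fix k :: 'd
  let ?\<phi> = "\<lambda>y :: real ^ 'd. f (y $ k)"
  let ?x = "\<lambda>i. t i *\<^sub>R axis k (1::real)"
  have gradient: "gradient ?\<phi> y = f' (y $ k) *\<^sub>R axis k 1" for y
    by (rule gradient_eqI, rule GDERIV_coordinate_function, rule deriv)
  have convex: "convex_on UNIV f"
    by (rule convex_on_realI[where f' = f']) (use deriv mono in \<open>auto dest: monoD\<close>)
  have "f s - f 0 \<ge> f' 0 * (s - 0)" for s
    using convex deriv by (intro convex_on_imp_above_tangent[where A = UNIV]) auto
  then have minimal: "f 0 \<le> f s" for s
    using critical by simp
  have "convex_on UNIV ?\<phi>"
    using convex_onD[OF convex] by (intro convex_onI) auto
  moreover have "?x (Suc i) = ?x i - (h / L) *\<^sub>R gradient ?\<phi> (?x i)" if "i < N" for i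
    using step[OF that] by (simp add: gradient scaleR_diff_left)
  ultimately show ?thesis
    using coordinate_function_in_C11[OF deriv lipschitz \<open>L \<ge> 0\<close>, where k = k] minimal start error
    by (intro exI[of _ ?\<phi>] exI[of _ 0] exI[of _ ?x]) simp
qed

lemma has_real_derivative_positive_part_squared:
  "((\<lambda>s::real. (max 0 s)\<^sup>2) has_real_derivative 2 * max 0 x) (at x)"
proof (cases x "0::real" rule: linorder_cases)
  case less
  have "((\<lambda>s::real. 0) has_real_derivative 2 * max 0 x) (at x)"
    using less by simp
  then show ?thesis
    by (rule has_field_derivative_transform_within_open[of _ _ _ "{..<0}"]) (use less in auto)
next
  case equal
  have "(max 0 s)\<^sup>2 = max 0 s * s" for s :: real
    by (simp add: max_def power2_eq_square)
  moreover have "isCont (\<lambda>s::real. max 0 s) 0"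
    by (intro continuous_intros)
  ultimately have "\<exists>g. (\<forall>s. (max 0 s)\<^sup>2 - (max 0 0)\<^sup>2 = g s * (s - 0)) \<and>
      isCont g 0 \<and> g 0 = (0::real)"
    by (intro exI[of _ "\<lambda>s. max 0 s"]) simp
  then show ?thesis
    unfolding CARAT_DERIV using equal by simp
next
  case greater
  have "((\<lambda>s::real. s\<^sup>2) has_real_derivative 2 * max 0 x) (at x)"
    using greater by (auto intro!: derivative_eq_intros)
  then show ?thesis
    by (rule has_field_derivative_transform_within_open[of _ _ _ "{0<..}"]) (use greater in auto)
qed

text \<open>The parabola \<open>L / 2 * t\<^sup>2\<close>, continued by its tangent line for \<open>t > a\<close>. Subtracting a square
  of a positive part expresses the two pieces in one formula.\<close>

definition half_huber :: "real \<Rightarrow> real \<Rightarrow> real \<Rightarrow> real" where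
  "half_huber L a t = L / 2 * (t\<^sup>2 - (max 0 (t - a))\<^sup>2)"

lemma half_huber_zero: "a \<ge> 0 \<Longrightarrow> half_huber L a 0 = 0"
  by (simp add: half_huber_def)

lemma half_huber_linear_part:
  assumes "t \<ge> a"
  shows "half_huber L a t = L * a * t - L * a\<^sup>2 / 2"
  using assms by (simp add: half_huber_def power2_eq_square field_simps)

lemma has_real_derivative_half_huber:
  "(half_huber L a has_real_derivative L * min t a) (at t)"
proof -
  have "((\<lambda>s. s - a) has_real_derivative 1) (at t)"
    by (auto intro!: derivative_eq_intros)
  from DERIV_chain2[OF has_real_derivative_positive_part_squared this]
  have "((\<lambda>s. (max 0 (s - a))\<^sup>2) has_real_derivative 2 * max 0 (t - a)) (at t)"
    by simp
  moreover have "((\<lambda>s. s\<^sup>2) has_real_derivative 2 * t) (at t)"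
    by (auto intro!: derivative_eq_intros)
  ultimately have "((\<lambda>s. L / 2 * (s\<^sup>2 - (max 0 (s - a))\<^sup>2)) has_real_derivative
      L / 2 * (2 * t - 2 * max 0 (t - a))) (at t)"
    by (intro DERIV_cmult DERIV_diff)
  moreover have "L / 2 * (2 * t - 2 * max 0 (t - a)) = L * min t a"
    by (simp add: max_def min_def)
  ultimately show ?thesis
    unfolding half_huber_def by (simp only:)
qed

theorem theorem3p2:
  fixes L R h :: real and N :: nat
  assumes "L > 0" and "R > 0" and "N \<ge> 1" and "h > 0"
  shows "\<exists>(\<phi> :: real ^ 'd \<Rightarrow> real) (xstar :: real ^ 'd) (x :: nat \<Rightarrow> real ^ 'd).
           \<phi> \<in> C11 L \<and> convex_on UNIV \<phi> \<and>
           (\<forall>y. \<phi> xstar \<le> \<phi> y) \<and>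
           norm (xstar - x 0) \<le> R \<and>
           (\<forall>i<N. x (Suc i) = x i - (h / L) *\<^sub>R gradient \<phi> (x i)) \<and>
           \<phi> (x N) - \<phi> xstar =
             L * R\<^sup>2 / 2 * max (1 / (2 * real N * h + 1)) ((1 - h) ^ (2 * N))"
proof (cases "1 / (2 * real N * h + 1) \<le> (1 - h) ^ (2 * N)")
  case True
  let ?f = "\<lambda>s::real. L / 2 * s\<^sup>2"
  let ?t = "\<lambda>i. (1 - h) ^ i * R"
  show ?thesis
  proof (rule gradient_method_along_coordinate[where f = ?f and f' = "(*) L" and t = ?t])
    show "(?f has_real_derivative L * s) (at s)" for s
      by (auto intro!: derivative_eq_intros)
    show "\<bar>L * s - L * u\<bar> \<le> L * \<bar>s - u\<bar>" for s u
      using \<open>L > 0\<close> by (simp add: abs_mult flip: right_diff_distrib)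
    show "mono ((*) L)"
      using \<open>L > 0\<close> by (intro monoI) simp
    show "?t (Suc i) = ?t i - h / L * (L * ?t i)" for i
      using \<open>L > 0\<close> by (simp add: algebra_simps)
    show "?f (?t N) - ?f 0 =
        L * R\<^sup>2 / 2 * max (1 / (2 * real N * h + 1)) ((1 - h) ^ (2 * N))"
      using True by (simp add: max_absorb2 power_mult_distrib mult.commute flip: power_mult)
  qed (use \<open>L > 0\<close> \<open>R > 0\<close> in simp_all)
next
  case False
  define D where "D = 2 * real N * h + 1"
  define a where "a = R / D"
  let ?f' = "\<lambda>s. L * min s a"
  let ?t = "\<lambda>i. R - real i * (h * a)"
  have "D > 0"
    using \<open>h > 0\<close> by (simp add: D_def add_nonneg_pos)
  then have "a > 0" and R_eq: "R = D * a"
    using \<open>R > 0\<close> by (simp_all add: a_def)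
  have on_line: "?t i \<ge> a" if "i \<le> N" for i
  proof -
    \<comment> \<open>The full slack is \<open>(2 * N - i) * h * a\<close>: the last iterate has covered only half of the
        distance to the point where the line meets the parabola.\<close>
    have "?t i - a = (2 * real N - real i) * (h * a)"
      by (simp add: R_eq D_def algebra_simps)
    also have "\<dots> \<ge> 0"
      using that \<open>h > 0\<close> \<open>a > 0\<close> by (intro mult_nonneg_nonneg) auto
    finally show ?thesis
      by simp
  qed
  show ?thesis
  proof (rule gradient_method_along_coordinate[where f = "half_huber L a" and f' = ?f' and t = ?t])
    show "(half_huber L a has_real_derivative ?f' s) (at s)" for s
      by (rule has_real_derivative_half_huber)
    show "\<bar>?f' s - ?f' u\<bar> \<le> L * \<bar>s - u\<bar>" for s u
    proof -
      have "\<bar>?f' s - ?f' u\<bar> = L * \<bar>min s a - min u a\<bar>"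
        using \<open>L > 0\<close> by (simp add: abs_mult flip: right_diff_distrib)
      also have "\<dots> \<le> L * \<bar>s - u\<bar>"
        using \<open>L > 0\<close> by (intro mult_left_mono) auto
      finally show ?thesis .
    qed
    show "mono ?f'"
      using \<open>L > 0\<close> by (intro monoI mult_left_mono) auto
    show "?t (Suc i) = ?t i - h / L * ?f' (?t i)" if "i < N" for i
      using on_line[of i] that \<open>L > 0\<close> by (simp add: min_absorb2 algebra_simps)
    show "half_huber L a (?t N) - half_huber L a 0 =
        L * R\<^sup>2 / 2 * max (1 / (2 * real N * h + 1)) ((1 - h) ^ (2 * N))"
    proof -
      have "half_huber L a (?t N) - half_huber L a 0 = L * a * ?t N - L * a\<^sup>2 / 2"
        using on_line[of N] \<open>a > 0\<close> by (simp add: half_huber_linear_part half_huber_zero)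
      also have "\<dots> = L * D * a\<^sup>2 / 2"
        by (simp add: R_eq D_def power2_eq_square field_simps)
      also have "\<dots> = L * R\<^sup>2 / 2 * (1 / D)"
        using \<open>D > 0\<close> by (simp add: R_eq power2_eq_square)
      finally show ?thesis
        using False by (simp add: D_def max_absorb1)
    qed
  qed (use \<open>L > 0\<close> \<open>R > 0\<close> \<open>a > 0\<close> in simp_all)
qed

end
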